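(* There is an absolute constant $C$ such that the following holds for every $c\ge 1$. If there exists a (deterministic, respectively randomized) online algorithm that is $c$-competitive for the Exponential Caching problem, then there exists a (deterministic, respectively randomized) online algorithm that is $C\cdot c$-competitive for the Min-Sum Set Cover problem.
   Context: Online Min-Sum Set Cover (MSSC): universe $U$ of $n$ elements; a permutation is a bijection $\pi:U\to\{1,\dots,n\}$ ($\pi(x)$ = position of $x$). Input: initial permutation $\pi_0$ and nonempty sets $R_1,\dots,R_m\subseteq U$ revealed online. Upon $R_t$, the algorithm pays access cost $\min_{x\in R_t}\pi_{t-1}(x)$, then chooses $\pi_t$ paying $d(\pi_{t-1},\pi_t)$, the number of pairs of elements ordered differently in the two permutations. Exponential Caching (EC): the universe has $n=2^w-1$ elements ($w\ge1$ an integer); with $[w]=\{0,\dots,w-1\}$, a partitioning $p:U\to[w]$ is valid if $|p^{-1}(i)|=2^i$ for all $i\in[w]$; write $\mathrm{size}(p,x)=2^{p(x)}$. Input: a valid $p_0$ and nonempty sets $R_1,\dots,R_m\subseteq U$ revealed online. Upon $R_t$, the algorithm pays access cost $\min_{x\in R_t}\mathrm{size}(p_{t-1},x)$, then chooses a valid $p_t$ and pays, for each $x$ with $p_t(x)\ne p_{t-1}(x)$, the movement cost $\max\{\mathrm{size}(p_{t-1},x),\mathrm{size}(p_t,x)\}$. In both problems the online algorithm decides without knowledge of future sets or of $m$, $\mathrm{OPT}(\mathcal I)$ is the minimum total cost of an offline solution, and an algorithm is $c$-competitive if there is $\xi$ with $\mathrm{ALG}(\mathcal I)\le c\cdot\mathrm{OPT}(\mathcal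 I)+\xi$ for all inputs $\mathcal I$ (expected cost for randomized algorithms). *)

theory Defs
  imports "HOL-Probability.Probability"
begin

text \<open>
  Universes are finite sets of natural numbers.  A configuration (a permutation, respectively a
  partitioning) is a function on the universe, made extensional so that equality of
  configurations is equality on the universe.  An online problem is taken over a fixed universe.
\<close>

type_synonym config = "nat \<Rightarrow> nat"

record online_problem =
  universe :: "nat set"
  configs :: "config set"
  access_cost :: "config \<Rightarrow> nat set \<Rightarrow> nat"
  move_cost :: "config \<Rightarrow> config \<Rightarrow> nat"

definition inputs :: "online_problem \<Rightarrow> (config \<times> nat set list) set" where
  "inputs P = {(s0, Rs). s0 \<in> configs P \<and> (\<forall>R\<in>set Rs. R \<noteq> {} \<and> R \<subseteq> universe P)}"

text \<open>
  The list entry \<open>Rs ! t\<close> is the set $R_{t+1}$; it is served in configuration \<open>s t\<close>, and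
  \<open>s (Suc t)\<close> is the configuration chosen afterwards.
\<close>

definition schedule_cost :: "online_problem \<Rightarrow> (nat \<Rightarrow> config) \<Rightarrow> nat set list \<Rightarrow> nat" where
  "schedule_cost P s Rs =
     (\<Sum>t<length Rs. access_cost P (s t) (Rs ! t) + move_cost P (s t) (s (Suc t)))"

definition OPT :: "online_problem \<Rightarrow> config \<Rightarrow> nat set list \<Rightarrow> nat" where
  "OPT P s0 Rs =
     Inf {schedule_cost P s Rs | s. s 0 = s0 \<and> (\<forall>t\<le>length Rs. s t \<in> configs P)}"

text \<open>
  A deterministic online algorithm maps the initial configuration and the nonempty list
  $R_1,\dots,R_t$ of sets revealed so far to the configuration chosen after $R_t$.
\<close>

type_synonym algorithm = "config \<Rightarrow> nat set list \<Rightarrow> config"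

definition det_algorithm :: "online_problem \<Rightarrow> algorithm \<Rightarrow> bool" where
  "det_algorithm P A \<longleftrightarrow> (\<forall>(s0, Rs)\<in>inputs P. Rs \<noteq> [] \<longrightarrow> A s0 Rs \<in> configs P)"

definition trajectory :: "algorithm \<Rightarrow> config \<Rightarrow> nat set list \<Rightarrow> nat \<Rightarrow> config" where
  "trajectory A s0 Rs t = (if t = 0 then s0 else A s0 (take t Rs))"

definition alg_cost :: "online_problem \<Rightarrow> algorithm \<Rightarrow> config \<Rightarrow> nat set list \<Rightarrow> nat" where
  "alg_cost P A s0 Rs = schedule_cost P (trajectory A s0 Rs) Rs"

definition det_competitive :: "online_problem \<Rightarrow> real \<Rightarrow> algorithm \<Rightarrow> bool" where
  "det_competitive P c A \<longleftrightarrow>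
     (\<exists>\<xi>::real. \<forall>(s0, Rs)\<in>inputs P. real (alg_cost P A s0 Rs) \<le> c * real (OPT P s0 Rs) + \<xi>)"

text \<open>
  A randomized online algorithm is a probability distribution over deterministic ones for which
  every decision is a random variable.  As there are finitely many configurations, the cost on
  each input is then a bounded random variable, hence integrable.
\<close>

definition rand_algorithm :: "online_problem \<Rightarrow> algorithm measure \<Rightarrow> bool" where
  "rand_algorithm P M \<longleftrightarrow>
     prob_space M \<and> (\<forall>A\<in>space M. det_algorithm P A) \<and>
     (\<forall>(s0, Rs)\<in>inputs P. Rs \<noteq> [] \<longrightarrow> (\<lambda>A. A s0 Rs) \<in> M \<rightarrow>\<^sub>M count_space UNIV)"

definition rand_competitive :: "online_problem \<Rightarrow> real \<Rightarrow> algorithm measure \<Rightarrow> bool" where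
  "rand_competitive P c M \<longleftrightarrow>
     (\<exists>\<xi>::real. \<forall>(s0, Rs)\<in>inputs P.
        (\<integral>A. real (alg_cost P A s0 Rs) \<partial>M) \<le> c * real (OPT P s0 Rs) + \<xi>)"

definition inversions :: "nat set \<Rightarrow> config \<Rightarrow> config \<Rightarrow> nat" where
  "inversions U \<pi> \<pi>' = card {(x, y). x \<in> U \<and> y \<in> U \<and> \<pi> x < \<pi> y \<and> \<pi>' y < \<pi>' x}"

definition mssc :: "nat set \<Rightarrow> online_problem" where
  "mssc U =
     \<lparr>universe = U,
      configs = {\<pi> \<in> extensional U. bij_betw \<pi> U {1..card U}},
      access_cost = (\<lambda>\<pi> R. Min (\<pi> ` R)),
      move_cost = inversions U\<rparr>"

definition psize :: "config \<Rightarrow> nat \<Rightarrow> nat" where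
  "psize p x = 2 ^ p x"

text \<open>Only meant for universes \<open>U\<close> with $2^w - 1$ elements.\<close>

definition exp_caching :: "nat \<Rightarrow> nat set \<Rightarrow> online_problem" where
  "exp_caching w U =
     \<lparr>universe = U,
      configs = {p \<in> U \<rightarrow>\<^sub>E {..<w}. \<forall>i<w. card {x \<in> U. p x = i} = 2 ^ i},
      access_cost = (\<lambda>p R. Min (psize p ` R)),
      move_cost = (\<lambda>p p'. \<Sum>x\<in>{x \<in> U. p' x \<noteq> p x}. max (psize p x) (psize p' x))\<rparr>"

end

theory Submission
  imports Defs "HOL-Library.Discrete_Functions"
begin

text \<open>
  Embed \<open>U\<close> into \<open>V\<close> and extend every permutation of \<open>U\<close> to positions on \<open>V\<close> by placing the
  remaining elements of \<open>V\<close> last, in a fixed order.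

  The online algorithm for Min-Sum Set Cover runs the one for Exponential Caching, started from
  the classes \<open>\<lfloor>log\<^sub>2 position\<rfloor>\<close>, and keeps its list stably sorted by class. Its access and
  reordering costs are then at most twice those of the caching algorithm.

  Conversely, an optimal sequence of permutations is turned into a caching schedule lazily: an
  element is moved to the next lower class only once its size exceeds four times its position.
  Writing \<open>p\<close> for the class and \<open>q\<close> for the position of an element, these moves are paid for by
  the potential \<open>\<Sum> max 0 (2 ^ p - 2 * q)\<close>, which starts at zero and grows by at most twice the
  number of inversions. Hence the caching optimum is at most eight times the list optimum.
\<close>

section \<open>Ranking by an injective key\<close>

text \<open>For a key injective on a finite \<open>U\<close> this is the permutation listing
  \<open>U\<close> by increasing key; the non-strict count makes positions start at 1.\<close>

definition rank_by :: "nat set \<Rightarrow> (nat \<Rightarrow> nat) \<Rightarrow> config" where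
  "rank_by U k = restrict (\<lambda>x. card {y \<in> U. k y \<le> k x}) U"

lemma rank_by_strict_mono:
  assumes "finite U" "x \<in> U" "y \<in> U" "k x < k y"
  shows "rank_by U k x < rank_by U k y"
proof -
  have "{z \<in> U. k z \<le> k x} \<subset> {z \<in> U. k z \<le> k y}"
    using assms by force
  then show ?thesis
    using assms by (simp add: rank_by_def psubset_card_mono)
qed

lemma rank_by_less_iff:
  assumes "finite U" "x \<in> U" "y \<in> U"
  shows "rank_by U k x < rank_by U k y \<longleftrightarrow> k x < k y"
proof
  assume less: "rank_by U k x < rank_by U k y"
  show "k x < k y"
  proof (rule ccontr)
    assume "\<not> k x < k y"
    then have "{z \<in> U. k z \<le> k y} \<subseteq> {z \<in> U. k z \<le> k x}" by auto
    then have "rank_by U k y \<le> rank_by U k x"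
      using assms by (simp add: rank_by_def card_mono)
    with less show False by simp
  qed
qed (use assms rank_by_strict_mono in blast)

lemma bij_betw_rank_by:
  assumes "finite U" "inj_on k U"
  shows "bij_betw (rank_by U k) U {1..card U}"
proof -
  have inj: "inj_on (rank_by U k) U"
  proof (rule inj_onI)
    fix x y assume xy: "x \<in> U" "y \<in> U" "rank_by U k x = rank_by U k y"
    then have "k x = k y"
      using rank_by_less_iff[OF assms(1), of x y k] rank_by_less_iff[OF assms(1), of y x k]
      by linarith
    with xy assms(2) show "x = y" by (simp add: inj_on_def)
  qed
  have "rank_by U k x \<in> {1..card U}" if "x \<in> U" for x
  proof -
    have "card {y \<in> U. k y \<le> k x} \<le> card U"
      using assms(1) by (intro card_mono) auto
    moreover have "card {y \<in> U. k y \<le> k x} > 0"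
      using assms(1) that by (subst card_gt_0_iff) auto
    ultimately show ?thesis using that by (simp add: rank_by_def)
  qed
  then have "rank_by U k ` U \<subseteq> {1..card U}" by blast
  moreover have "card (rank_by U k ` U) = card {1..card U}"
    using inj by (simp add: card_image)
  ultimately have "rank_by U k ` U = {1..card U}"
    by (intro card_subset_eq) auto
  with inj show ?thesis by (simp add: bij_betw_def)
qed

section \<open>Permutations\<close>

lemma mssc_simps [simp]:
  "universe (mssc U) = U"
  "configs (mssc U) = {\<pi> \<in> extensional U. bij_betw \<pi> U {1..card U}}"
  "access_cost (mssc U) \<pi> R = Min (\<pi> ` R)"
  "move_cost (mssc U) = inversions U"
  by (simp_all add: mssc_def)

lemma card_positions_le:
  assumes "bij_betw \<pi> U {1..card U}" "x \<in> U"
  shows "card {y \<in> U. \<pi> y \<le> \<pi> x} = \<pi> x"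
proof -
  have "bij_betw \<pi> {y \<in> U. \<pi> y \<le> \<pi> x} {i \<in> {1..card U}. i \<le> \<pi> x}"
    using assms(1) by (auto simp: bij_betw_def inj_on_def)
  moreover have "{i \<in> {1..card U}. i \<le> \<pi> x} = {1..\<pi> x}"
    using bij_betwE[OF assms(1)] assms(2) by force
  ultimately show ?thesis by (simp add: bij_betw_same_card)
qed

text \<open>An element moving forward by d places must overtake at least d elements that stood ahead
  of it, and each inversion has only one overtaking element. Truncated subtraction ignores backward
  moves.\<close>

lemma sum_forward_shifts_le_inversions:
  assumes "finite U" "bij_betw \<pi> U {1..card U}" "bij_betw \<pi>' U {1..card U}"
  shows "(\<Sum>x\<in>U. \<pi> x - \<pi>' x) \<le> inversions U \<pi> \<pi>'"
proof -
  have "\<pi> x - \<pi>' x \<le> card {y \<in> U. \<pi> y < \<pi> x \<and> \<pi>' x < \<pi>' y}" if x: "x \<in> U" for x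
  proof -
    have "{y \<in> U. \<pi> y \<le> \<pi> x} \<subseteq> {y \<in> U. \<pi>' y \<le> \<pi>' x} \<union> {y \<in> U. \<pi> y < \<pi> x \<and> \<pi>' x < \<pi>' y}"
      using x assms(2) by (auto simp: bij_betw_def inj_on_def order.order_iff_strict)
    then have "card {y \<in> U. \<pi> y \<le> \<pi> x}
        \<le> card ({y \<in> U. \<pi>' y \<le> \<pi>' x} \<union> {y \<in> U. \<pi> y < \<pi> x \<and> \<pi>' x < \<pi>' y})"
      using assms(1) by (intro card_mono) auto
    also have "\<dots> \<le> card {y \<in> U. \<pi>' y \<le> \<pi>' x} + card {y \<in> U. \<pi> y < \<pi> x \<and> \<pi>' x < \<pi>' y}"
      by (rule card_Un_le)
    finally show ?thesis
      using card_positions_le[OF assms(2) x] card_positions_le[OF assms(3) x] by linarith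
  qed
  then have "(\<Sum>x\<in>U. \<pi> x - \<pi>' x) \<le> (\<Sum>x\<in>U. card {y \<in> U. \<pi> y < \<pi> x \<and> \<pi>' x < \<pi>' y})"
    by (rule sum_mono)
  also have "\<dots> = card (SIGMA x:U. {y \<in> U. \<pi> y < \<pi> x \<and> \<pi>' x < \<pi>' y})"
    using assms(1) by simp
  \<comment> \<open>\<open>inversions\<close> names the overtaken element first, the sum above the
    overtaking one.\<close>
  also have "\<dots> = card (prod.swap ` (SIGMA x:U. {y \<in> U. \<pi> y < \<pi> x \<and> \<pi>' x < \<pi>' y}))"
    by (rule card_image[symmetric]) simp
  also have "prod.swap ` (SIGMA x:U. {y \<in> U. \<pi> y < \<pi> x \<and> \<pi>' x < \<pi>' y})
      = {(x, y). x \<in> U \<and> y \<in> U \<and> \<pi> x < \<pi> y \<and> \<pi>' y < \<pi>' x}"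
    by (auto simp: image_iff)
  finally show ?thesis by (simp add: inversions_def)
qed

section \<open>Partitionings\<close>

lemma exp_caching_simps [simp]:
  "universe (exp_caching w V) = V"
  "configs (exp_caching w V) = {p \<in> V \<rightarrow>\<^sub>E {..<w}. \<forall>i<w. card {x \<in> V. p x = i} = 2 ^ i}"
  "access_cost (exp_caching w V) p R = Min (psize p ` R)"
  "move_cost (exp_caching w V) p p' =
     (\<Sum>x\<in>{x \<in> V. p' x \<noteq> p x}. max (psize p x) (psize p' x))"
  by (simp_all add: exp_caching_def)

text \<open>Geometric sum of the class sizes; classes from \<open>w\<close> on are empty, so
  \<open>k\<close> may exceed \<open>w\<close>.\<close>

lemma card_lower_classes:
  assumes "p \<in> configs (exp_caching w V)"
  shows "card {v \<in> V. p v < k} \<le> 2 ^ k"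
proof -
  have cls: "card {v \<in> V. p v = i} \<le> 2 ^ i" for i
  proof (cases "i < w")
    case False
    then have "{v \<in> V. p v = i} = {}" using assms by (auto simp: PiE_iff)
    then show ?thesis by (simp only: card.empty)
  qed (use assms in auto)
  have "{v \<in> V. p v < k} = (\<Union>i<k. {v \<in> V. p v = i})" by auto
  then have "card {v \<in> V. p v < k} \<le> (\<Sum>i<k. card {v \<in> V. p v = i})"
    by (simp add: card_UN_le)
  also have "\<dots> \<le> (\<Sum>i<k. 2 ^ i)" by (rule sum_mono) (rule cls)
  also have "\<dots> \<le> 2 ^ k" by (induction k) auto
  finally show ?thesis .
qed

text \<open>Holds element by element: if the class differs between \<open>p\<close> and
  \<open>r\<close>, the class under \<open>q\<close> differs from at least one of them, and the
  maxima paid on the way cover both end sizes.\<close>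

lemma exp_caching_move_triangle:
  assumes "finite V"
  shows "move_cost (exp_caching w V) p r
    \<le> move_cost (exp_caching w V) p q + move_cost (exp_caching w V) q r"
proof -
  have eq: "move_cost (exp_caching w V) a b
      = (\<Sum>x\<in>V. if b x \<noteq> a x then max (psize a x) (psize b x) else 0)" for a b
    using assms by (simp add: sum.inter_filter)
  show ?thesis
    unfolding eq sum.distrib[symmetric] by (rule sum_mono) (auto simp: psize_def)
qed

section \<open>Partitionings that follow a permutation\<close>

definition excess :: "nat set \<Rightarrow> config \<Rightarrow> (nat \<Rightarrow> nat) \<Rightarrow> nat" where
  "excess V p q = (\<Sum>v\<in>V. 2 ^ p v - 2 * q v)"

text \<open>Lowering \<open>q v\<close> by d raises the truncated term of \<open>v\<close> by at
  most 2 d; raising \<open>q v\<close> never increases it.\<close>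

lemma excess_shift:
  "excess V p q' \<le> excess V p q + 2 * (\<Sum>v\<in>V. q v - q' v)"
  unfolding excess_def sum_distrib_left sum.distrib[symmetric] by (rule sum_mono) simp

lemma swap_configs:
  assumes "p \<in> configs (exp_caching w V)" "x \<in> V" "y \<in> V"
  shows "p(x := p y, y := p x) \<in> configs (exp_caching w V)"
proof -
  let ?p = "p(x := p y, y := p x)"
  \<comment> \<open>The transposition of \<open>x\<close> and \<open>y\<close> is its own inverse
    and maps each new class onto the old class of the same index.\<close>
  let ?s = "\<lambda>v. if v = x then y else if v = y then x else v"
  have "bij_betw ?s {v \<in> V. ?p v = i} {v \<in> V. p v = i}" for i
    by (rule bij_betwI[where g = ?s]) (use assms in auto)
  then have "card {v \<in> V. ?p v = i} = card {v \<in> V. p v = i}" for i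
    using bij_betw_same_card by blast
  then show ?thesis using assms by (auto simp: PiE_iff extensional_def)
qed

text \<open>
  An element \<open>x\<close> of class \<open>k\<close> with \<open>4 * q x < 2 ^ k\<close> is exchanged with an element \<open>y\<close> of class
  \<open>k - 1\<close> with \<open>q y \<ge> 2 ^ (k - 1)\<close>, which exists because \<open>q\<close> is injective and positive. This
  costs \<open>2 * 2 ^ k\<close> and lowers the excess by at least \<open>2 ^ (k - 1)\<close>, as \<open>y\<close> ends up with none.
\<close>

lemma reduce_excess:
  assumes V: "finite V" and q: "inj_on q V" "\<And>v. v \<in> V \<Longrightarrow> q v \<ge> 1"
    and p: "p \<in> configs (exp_caching w V)" and x: "x \<in> V" "4 * q x < 2 ^ p x"
  obtains p' where "p' \<in> configs (exp_caching w V)" "excess V p' q < excess V p q"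
    "move_cost (exp_caching w V) p p' + 4 * excess V p' q \<le> 4 * excess V p q"
proof -
  \<comment> \<open>From here on \<open>k\<close> is the class of \<open>y\<close>, one below that
    of \<open>x\<close>, so the exchange costs \<open>4 * 2 ^ k\<close> and must lower the excess by
    \<open>2 ^ k\<close>.\<close>
  obtain k where k: "p x = Suc k"
    using x q(2)[OF x(1)] by (cases "p x") auto
  have kw: "k < w" using p x(1) k by (force simp: PiE_iff)
  have "\<exists>y\<in>V. p y = k \<and> 2 ^ k \<le> q y"
  proof (rule ccontr)
    assume "\<not> ?thesis"
    then have "q ` {y \<in> V. p y = k} \<subseteq> {1..<2 ^ k}" using q(2) by force
    then have "card (q ` {y \<in> V. p y = k}) \<le> card {1..<(2::nat) ^ k}"
      by (intro card_mono) auto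
    moreover have "card (q ` {y \<in> V. p y = k}) = 2 ^ k"
      using p kw by (subst card_image) (auto intro: inj_on_subset[OF q(1)])
    moreover have "card {1..<(2::nat) ^ k} < 2 ^ k" by simp
    ultimately show False by linarith
  qed
  then obtain y where y: "y \<in> V" "p y = k" "2 ^ k \<le> q y" by blast
  have "x \<noteq> y" using k y by auto
  let ?p = "p(x := p y, y := p x)"
  let ?W = "V - {x, y}"
  have split: "sum f V = f x + f y + sum f ?W" for f :: "nat \<Rightarrow> nat"
  proof -
    have "sum f V = sum f {x, y} + sum f ?W"
      using V x y by (subst sum.subset_diff[of "{x, y}"]) auto
    then show ?thesis using \<open>x \<noteq> y\<close> by simp
  qed
  have rest: "(\<Sum>v\<in>?W. 2 ^ ?p v - 2 * q v) = (\<Sum>v\<in>?W. 2 ^ p v - 2 * q v)"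
    by (rule sum.cong) auto
  have new: "excess V ?p q = (2 ^ k - 2 * q x) + (\<Sum>v\<in>?W. 2 ^ p v - 2 * q v)"
    unfolding excess_def split rest using \<open>x \<noteq> y\<close> k y by simp
  have old: "excess V p q \<ge> (2 * 2 ^ k - 2 * q x) + (\<Sum>v\<in>?W. 2 ^ p v - 2 * q v)"
    unfolding excess_def split using k by simp
  have "{v \<in> V. ?p v \<noteq> p v} = {x, y}" using x y k \<open>x \<noteq> y\<close> by auto
  then have move: "move_cost (exp_caching w V) p ?p = 4 * 2 ^ k"
    using \<open>x \<noteq> y\<close> k y by (simp add: psize_def)
  \<comment> \<open>The threshold 4 gives \<open>2 * q x < 2 ^ k\<close>, so neither subtraction is
    truncated and \<open>x\<close> alone yields the full drop.\<close>
  have drop: "2 ^ k + (2 ^ k - 2 * q x) = 2 * 2 ^ k - 2 * q x"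
    using x(2) k by simp
  have less: "excess V ?p q + 2 ^ k \<le> excess V p q"
    using new old drop by linarith
  show thesis
  proof (rule that[OF swap_configs[OF p x(1) y(1)]])
    have "(2::nat) ^ k > 0" by simp
    then show "excess V ?p q < excess V p q" using less by linarith
    show "move_cost (exp_caching w V) p ?p + 4 * excess V ?p q \<le> 4 * excess V p q"
      unfolding move using less by linarith
  qed
qed

text \<open>Exchanges are repeated while some element is too large for its position. The strictly
  falling excess ensures termination, and the triangle inequality merges the exchanges into one
  move.\<close>

lemma settle:
  assumes V: "finite V" and q: "inj_on q V" "\<And>v. v \<in> V \<Longrightarrow> q v \<ge> 1"
    and p: "p \<in> configs (exp_caching w V)"
  shows "\<exists>p'\<in>configs (exp_caching w V). (\<forall>v\<in>V. 2 ^ p' v \<le> 4 * q v) \<and>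
    move_cost (exp_caching w V) p p' + 4 * excess V p' q \<le> 4 * excess V p q"
  using p
proof (induction "excess V p q" arbitrary: p rule: less_induct)
  case less
  show ?case
  proof (cases "\<forall>v\<in>V. 2 ^ p v \<le> 4 * q v")
    case True
    moreover have "move_cost (exp_caching w V) p p = 0" by simp
    ultimately show ?thesis using less.prems by (intro bexI[of _ p]) auto
  next
    case False
    then obtain x where "x \<in> V" "4 * q x < 2 ^ p x" by force
    then obtain r where r: "r \<in> configs (exp_caching w V)" "excess V r q < excess V p q"
      "move_cost (exp_caching w V) p r + 4 * excess V r q \<le> 4 * excess V p q"
      using reduce_excess[OF V q less.prems] by metis
    from less.hyps[OF r(2,1)] obtain p' where p': "p' \<in> configs (exp_caching w V)"
      "\<forall>v\<in>V. 2 ^ p' v \<le> 4 * q v"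
      "move_cost (exp_caching w V) r p' + 4 * excess V p' q \<le> 4 * excess V r q" by blast
    have "move_cost (exp_caching w V) p p' + 4 * excess V p' q \<le> 4 * excess V p q"
      using exp_caching_move_triangle[OF V, of w p p' r] r(3) p'(3) by linarith
    with p' show ?thesis by blast
  qed
qed



section \<open>Randomized algorithms over finitely many configurations\<close>

lemma trajectory_configs:
  assumes "det_algorithm P A" "(s, Rs) \<in> inputs P" "t \<le> length Rs"
  shows "trajectory A s Rs t \<in> configs P"
proof (cases "t = 0")
  case True
  then show ?thesis using assms(2) by (simp add: trajectory_def inputs_def)
next
  case False
  moreover have "(s, take t Rs) \<in> inputs P"
    using assms(2) by (auto simp: inputs_def dest: in_set_takeD)
  moreover have "take t Rs \<noteq> []" using False assms(3) by auto
  ultimately show ?thesis using assms(1) by (auto simp: trajectory_def det_algorithm_def)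
qed

text \<open>The target is \<open>configs P\<close> rather than all functions: once it is finite,
  functions of several random configurations can be split by the value of one of them.\<close>

lemma measurable_trajectory:
  assumes M: "rand_algorithm P M" and inp: "(s, Rs) \<in> inputs P" and t: "t \<le> length Rs"
  shows "(\<lambda>A. trajectory A s Rs t) \<in> M \<rightarrow>\<^sub>M count_space (configs P)"
proof (rule measurable_count_space_extend[of _ UNIV])
  show "(\<lambda>A. trajectory A s Rs t) \<in> space M \<rightarrow> configs P"
    using M trajectory_configs[OF _ inp t] by (auto simp: rand_algorithm_def)
  show "(\<lambda>A. trajectory A s Rs t) \<in> M \<rightarrow>\<^sub>M count_space UNIV"
  proof (cases "t = 0")
    case False
    then have "take t Rs \<noteq> []" using t by auto
    moreover have "(s, take t Rs) \<in> inputs P"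
      using inp by (auto simp: inputs_def dest: in_set_takeD)
    ultimately show ?thesis
      using M False by (auto simp: trajectory_def rand_algorithm_def)
  qed (simp add: trajectory_def)
qed simp

lemma integrable_alg_cost:
  assumes fin: "finite (configs P)" and M: "rand_algorithm P M" and inp: "(s, Rs) \<in> inputs P"
  shows "integrable M (\<lambda>A. real (alg_cost P A s Rs))"
proof -
  interpret prob_space M using M by (simp add: rand_algorithm_def)
  let ?s = "\<lambda>A. trajectory A s Rs"
  have access: "integrable M (\<lambda>A. real (access_cost P (?s A t) (Rs ! t)))"
    if t: "t < length Rs" for t
  proof (rule integrable_const_bound)
    show "(\<lambda>A. real (access_cost P (?s A t) (Rs ! t))) \<in> borel_measurable M"
      by (rule measurable_compose[OF measurable_trajectory[OF M inp]]) (use t in auto)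
    show "AE A in M. norm (real (access_cost P (?s A t) (Rs ! t)))
        \<le> real (\<Sum>c\<in>configs P. access_cost P c (Rs ! t))"
    proof (rule AE_I2)
      fix A assume "A \<in> space M"
      then have "?s A t \<in> configs P"
        using M t by (intro trajectory_configs[OF _ inp]) (auto simp: rand_algorithm_def)
      then have "access_cost P (?s A t) (Rs ! t) \<le> (\<Sum>c\<in>configs P. access_cost P c (Rs ! t))"
        using fin by (intro member_le_sum) auto
      then show "norm (real (access_cost P (?s A t) (Rs ! t)))
        \<le> real (\<Sum>c\<in>configs P. access_cost P c (Rs ! t))"
        unfolding real_norm_def abs_of_nat of_nat_le_iff .
    qed
  qed
  have move: "integrable M (\<lambda>A. real (move_cost P (?s A t) (?s A (Suc t))))"
    if t: "t < length Rs" for t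
  proof (rule integrable_const_bound)
    show "(\<lambda>A. real (move_cost P (?s A t) (?s A (Suc t)))) \<in> borel_measurable M"
    \<comment> \<open>The cost depends on two random configurations; fixing the value
      \<open>c\<close> of the first leaves a function of the second alone.\<close>
    proof (rule measurable_compose_countable'[where I = "configs P"
          and f = "\<lambda>c A. real (move_cost P c (?s A (Suc t)))"])
      fix c
      show "(\<lambda>A. real (move_cost P c (?s A (Suc t)))) \<in> borel_measurable M"
        by (rule measurable_compose[OF measurable_trajectory[OF M inp]]) (use t in auto)
    qed (use t fin measurable_trajectory[OF M inp] in \<open>auto intro: countable_finite\<close>)
    show "AE A in M. norm (real (move_cost P (?s A t) (?s A (Suc t))))
        \<le> real (\<Sum>(c, c')\<in>configs P \<times> configs P. move_cost P c c')"
    proof (rule AE_I2)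
      fix A assume A: "A \<in> space M"
      have "?s A t \<in> configs P" "?s A (Suc t) \<in> configs P"
        using M t A by (auto simp: rand_algorithm_def intro!: trajectory_configs[OF _ inp])
      then have "(\<lambda>(c, c'). move_cost P c c') (?s A t, ?s A (Suc t))
          \<le> (\<Sum>(c, c')\<in>configs P \<times> configs P. move_cost P c c')"
        using fin by (intro member_le_sum) auto
      then show "norm (real (move_cost P (?s A t) (?s A (Suc t))))
        \<le> real (\<Sum>(c, c')\<in>configs P \<times> configs P. move_cost P c c')"
        unfolding real_norm_def abs_of_nat of_nat_le_iff by simp
    qed
  qed
  show ?thesis
    unfolding alg_cost_def schedule_cost_def of_nat_sum of_nat_add
    by (intro Bochner_Integration.integrable_sum Bochner_Integration.integrable_add access move) auto
qed

text \<open>The smallest sigma-algebra on deterministic algorithms that makes every decision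
  measurable; it carries the image measure of a randomized algorithm.\<close>

definition decision_algebra :: "online_problem \<Rightarrow> algorithm measure" where
  "decision_algebra P = sigma {A. det_algorithm P A}
     {{A. det_algorithm P A \<and> A s Rs \<in> X} | s Rs X. (s, Rs) \<in> inputs P \<and> Rs \<noteq> []}"

lemma space_decision_algebra: "space (decision_algebra P) = {A. det_algorithm P A}"
  unfolding decision_algebra_def by (rule space_measure_of) auto

lemma measurable_decision:
  assumes "(s, Rs) \<in> inputs P" "Rs \<noteq> []"
  shows "(\<lambda>A. A s Rs) \<in> decision_algebra P \<rightarrow>\<^sub>M count_space UNIV"
proof (rule measurableI)
  fix X :: "config set"
  have "(\<lambda>A. A s Rs) -` X \<inter> space (decision_algebra P) = {A. det_algorithm P A \<and> A s Rs \<in> X}"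
    by (auto simp: space_decision_algebra)
  also have "\<dots> \<in> sets (decision_algebra P)"
    unfolding decision_algebra_def using assms by (subst sets_measure_of) auto
  finally show "(\<lambda>A. A s Rs) -` X \<inter> space (decision_algebra P) \<in> sets (decision_algebra P)" .
qed simp

text \<open>Preimages need checking on generators only, so a transformation of algorithms can be
  tested one decision at a time.\<close>

lemma measurable_into_decision_algebra:
  assumes "\<And>A. A \<in> space M \<Longrightarrow> det_algorithm P (F A)"
    and "\<And>s Rs. (s, Rs) \<in> inputs P \<Longrightarrow> Rs \<noteq> [] \<Longrightarrow> (\<lambda>A. F A s Rs) \<in> M \<rightarrow>\<^sub>M count_space UNIV"
  shows "F \<in> M \<rightarrow>\<^sub>M decision_algebra P"
  unfolding decision_algebra_def
proof (rule measurable_measure_of)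
  fix Y assume "Y \<in> {{A. det_algorithm P A \<and> A s Rs \<in> X} | s Rs X. (s, Rs) \<in> inputs P \<and> Rs \<noteq> []}"
  then obtain s Rs X where Y: "Y = {A. det_algorithm P A \<and> A s Rs \<in> X}"
    "(s, Rs) \<in> inputs P" "Rs \<noteq> []" by blast
  have "F -` Y \<inter> space M = (\<lambda>A. F A s Rs) -` X \<inter> space M" using assms(1) Y(1) by auto
  also have "\<dots> \<in> sets M" by (rule measurable_sets[OF assms(2)[OF Y(2,3)]]) simp
  finally show "F -` Y \<inter> space M \<in> sets M" .
qed (use assms(1) in auto)

lemma rand_algorithm_distr:
  assumes "prob_space M" "F \<in> M \<rightarrow>\<^sub>M decision_algebra P"
  shows "rand_algorithm P (distr M (decision_algebra P) F)"
proof -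
  have "(\<lambda>A. A s Rs) \<in> distr M (decision_algebra P) F \<rightarrow>\<^sub>M count_space UNIV"
    if "(s, Rs) \<in> inputs P" "Rs \<noteq> []" for s Rs
    using measurable_decision[OF that] by (simp add: measurable_distr_eq1)
  then show ?thesis
    using prob_space.prob_space_distr[OF assms]
    unfolding rand_algorithm_def space_distr space_decision_algebra by blast
qed

section \<open>The reduction\<close>

text \<open>\<beta> assigns the elements of \<open>V\<close> outside the image of \<open>U\<close>
  the positions after \<open>card U\<close>; with \<open>card_U\<close> this forces \<open>V\<close>
  to have \<open>2 ^ w - 1\<close> elements.\<close>

locale embedding =
  fixes w :: nat and V U :: "nat set" and e \<beta> :: "nat \<Rightarrow> nat"
  assumes finite_V: "finite V" and finite_U: "finite U"
    and card_U: "card U \<le> 2 ^ w - 1"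
    and inj_e: "inj_on e U" and e_into: "e ` U \<subseteq> V"
    and bij_\<beta>: "bij_betw \<beta> (V - e ` U) {card U + 1..2 ^ w - 1}"
begin

abbreviation EC :: online_problem where "EC \<equiv> exp_caching w V"
abbreviation MS :: online_problem where "MS \<equiv> mssc U"
abbreviation lift_sets :: "nat set list \<Rightarrow> nat set list" where "lift_sets \<equiv> map ((`) e)"

lemma e_mem: "x \<in> U \<Longrightarrow> e x \<in> V"
  using e_into by blast

section \<open>Extended positions and the initial partitioning\<close>

definition pos :: "config \<Rightarrow> nat \<Rightarrow> nat" where
  "pos \<pi> v = (if v \<in> e ` U then \<pi> (inv_into U e v) else \<beta> v)"

lemma pos_e: "x \<in> U \<Longrightarrow> pos \<pi> (e x) = \<pi> x"
  using inj_e by (simp add: pos_def)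

lemma bij_betw_pos:
  assumes "\<pi> \<in> configs MS"
  shows "bij_betw (pos \<pi>) V {1..2 ^ w - 1}"
proof -
  have "bij_betw (inv_into U e) (e ` U) U"
    using inj_e by (simp add: inj_on_imp_bij_betw bij_betw_inv_into)
  then have "bij_betw (\<pi> \<circ> inv_into U e) (e ` U) {1..card U}"
    using assms by (auto intro: bij_betw_trans)
  then have "bij_betw (\<lambda>v. if v \<in> e ` U then (\<pi> \<circ> inv_into U e) v else \<beta> v)
      (e ` U \<union> (V - e ` U)) ({1..card U} \<union> {card U + 1..2 ^ w - 1})"
    using bij_\<beta> by (rule bij_betw_disjoint_Un) auto
  moreover have "e ` U \<union> (V - e ` U) = V" using e_into by blast
  moreover have "{1..card U} \<union> {card U + 1..2 ^ w - 1} = {1..2 ^ w - 1}"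
    using card_U by auto
  moreover have "pos \<pi> = (\<lambda>v. if v \<in> e ` U then (\<pi> \<circ> inv_into U e) v else \<beta> v)"
    by (auto simp: pos_def)
  ultimately show ?thesis by simp
qed

lemma pos_inj: "\<pi> \<in> configs MS \<Longrightarrow> inj_on (pos \<pi>) V"
  using bij_betw_pos bij_betw_imp_inj_on by blast

lemma pos_ge_1: "\<pi> \<in> configs MS \<Longrightarrow> v \<in> V \<Longrightarrow> pos \<pi> v \<ge> 1"
  using bij_betwE[OF bij_betw_pos] by fastforce

definition initial_partitioning :: "config \<Rightarrow> config" where
  "initial_partitioning \<pi> = restrict (\<lambda>v. floor_log (pos \<pi> v)) V"

lemma two_power_initial_partitioning_le:
  assumes "\<pi> \<in> configs MS" "v \<in> V"
  shows "2 ^ initial_partitioning \<pi> v \<le> pos \<pi> v"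
  using pos_ge_1[OF assms] assms(2) floor_log_exp2_le[of "pos \<pi> v"]
  by (simp add: initial_partitioning_def)

text \<open>Class \<open>i\<close> consists of the elements at positions from \<open>2 ^ i\<close>
  to \<open>2 ^ Suc i - 1\<close>. For \<open>i < w\<close> all these positions occur, so the class
  has \<open>2 ^ i\<close> elements.\<close>

lemma initial_partitioning_configs:
  assumes "\<pi> \<in> configs MS"
  shows "initial_partitioning \<pi> \<in> configs EC"
proof -
  have log: "floor_log n = i \<longleftrightarrow> n \<in> {2 ^ i..<2 ^ Suc i}" if "n \<ge> 1" for n i
  proof
    assume "floor_log n = i"
    then show "n \<in> {2 ^ i..<2 ^ Suc i}"
      using floor_log_exp2_le[of n] floor_log_exp2_gt[of n] that by auto
  next
    assume "n \<in> {2 ^ i..<2 ^ Suc i}"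
    then show "floor_log n = i" using that by (intro floor_log_eqI) auto
  qed
  have range: "floor_log (pos \<pi> v) < w" if "v \<in> V" for v
  proof -
    have "pos \<pi> v \<le> 2 ^ w - 1"
      using bij_betwE[OF bij_betw_pos[OF assms]] that by force
    moreover have "2 ^ floor_log (pos \<pi> v) \<le> pos \<pi> v"
      using pos_ge_1[OF assms that] floor_log_exp2_le[of "pos \<pi> v"] by simp
    ultimately have "2 ^ floor_log (pos \<pi> v) \<le> (2::nat) ^ w - 1" by linarith
    moreover have "(2::nat) ^ w - 1 < 2 ^ w" by simp
    ultimately have "(2::nat) ^ floor_log (pos \<pi> v) < 2 ^ w" by linarith
    then show ?thesis by simp
  qed
  have "card {v \<in> V. initial_partitioning \<pi> v = i} = 2 ^ i" if "i < w" for i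
  proof -
    have "{v \<in> V. initial_partitioning \<pi> v = i} = {v \<in> V. pos \<pi> v \<in> {2 ^ i..<2 ^ Suc i}}"
      using log pos_ge_1[OF assms] by (auto simp: initial_partitioning_def)
    moreover have "bij_betw (pos \<pi>) {v \<in> V. pos \<pi> v \<in> {2 ^ i..<2 ^ Suc i}} {2 ^ i..<2 ^ Suc i}"
    proof -
      have "(2::nat) ^ Suc i \<le> 2 ^ w" using that by (intro power_increasing) auto
      then have "{2 ^ i..<2 ^ Suc i} \<subseteq> {1..(2::nat) ^ w - 1}" by auto
      then have "{2 ^ i..<2 ^ Suc i} \<subseteq> pos \<pi> ` V"
        using bij_betw_pos[OF assms] by (simp add: bij_betw_def)
      then have "pos \<pi> ` {v \<in> V. pos \<pi> v \<in> {2 ^ i..<2 ^ Suc i}} = {2 ^ i..<2 ^ Suc i}"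
        by blast
      then show ?thesis
        by (rule bij_betw_imageI[rotated]) (auto intro: inj_on_subset[OF pos_inj[OF assms]])
    qed
    ultimately show ?thesis using bij_betw_same_card by fastforce
  qed
  then show ?thesis using range by (auto simp: initial_partitioning_def)
qed

subsection \<open>Permutations that follow a partitioning\<close>

text \<open>The invariant through which list costs are charged to the caching algorithm; the order
  inside a class is left free.\<close>

definition consistent :: "config \<Rightarrow> config \<Rightarrow> bool" where
  "consistent p \<pi> \<longleftrightarrow> (\<forall>x\<in>U. \<forall>y\<in>U. \<pi> x < \<pi> y \<longrightarrow> p (e x) \<le> p (e y))"

text \<open>As \<open>\<pi> x \<le> card U\<close>, the key orders lexicographically by class and then by old position.\<close>

definition sort_key :: "config \<Rightarrow> config \<Rightarrow> nat \<Rightarrow> nat" where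
  "sort_key p \<pi> x = p (e x) * Suc (card U) + \<pi> x"

definition reorder :: "config \<Rightarrow> config \<Rightarrow> config" where
  "reorder p \<pi> = rank_by U (sort_key p \<pi>)"

lemma sort_key_less:
  assumes "\<pi> \<in> configs MS" "x \<in> U" "p (e x) < p (e y)"
  shows "sort_key p \<pi> x < sort_key p \<pi> y"
proof -
  have "\<pi> x \<le> card U" using assms by (auto simp: bij_betw_def)
  then have "sort_key p \<pi> x < Suc (p (e x)) * Suc (card U)" by (simp add: sort_key_def)
  also have "\<dots> \<le> p (e y) * Suc (card U)"
    using assms(3) by (intro mult_le_mono1) simp
  finally show ?thesis by (simp add: sort_key_def)
qed

lemma initial_partitioning_consistent:
  "\<pi> \<in> configs MS \<Longrightarrow> consistent (initial_partitioning \<pi>) \<pi>"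
  by (simp add: consistent_def initial_partitioning_def e_mem pos_e floor_log_le_iff)

lemma reorder_less_imp:
  assumes "\<pi> \<in> configs MS" "x \<in> U" "y \<in> U" "reorder p \<pi> x < reorder p \<pi> y"
  shows "p (e x) < p (e y) \<or> p (e x) = p (e y) \<and> \<pi> x < \<pi> y"
proof -
  have less: "sort_key p \<pi> x < sort_key p \<pi> y"
    using assms rank_by_less_iff[OF finite_U] by (simp add: reorder_def)
  then have "p (e x) \<le> p (e y)"
    using sort_key_less[OF assms(1,3), of p x] by (meson leI order_less_asym)
  then show ?thesis using less by (auto simp: sort_key_def)
qed

lemma reorder_configs:
  assumes "\<pi> \<in> configs MS"
  shows "reorder p \<pi> \<in> configs MS"
proof -
  have "inj_on (sort_key p \<pi>) U"
  proof (rule inj_onI)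
    fix x y assume xy: "x \<in> U" "y \<in> U" "sort_key p \<pi> x = sort_key p \<pi> y"
    then have "p (e x) = p (e y)"
      using sort_key_less[OF assms xy(1), of p y] sort_key_less[OF assms xy(2), of p x]
      by (metis less_irrefl nat_neq_iff)
    with xy have "\<pi> x = \<pi> y" by (simp add: sort_key_def)
    with xy assms show "x = y" by (auto simp: bij_betw_def inj_on_def)
  qed
  from bij_betw_rank_by[OF finite_U this] show ?thesis
    by (simp add: reorder_def rank_by_def)
qed

lemma reorder_consistent: "\<pi> \<in> configs MS \<Longrightarrow> consistent p (reorder p \<pi>)"
  unfolding consistent_def by (intro ballI impI, drule (3) reorder_less_imp) auto

text \<open>Carries bounds on class sizes from \<open>V\<close> back to \<open>U\<close>.\<close>

lemma card_preimage_le: "card {x \<in> U. P (e x)} \<le> card {v \<in> V. P v}"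
proof (rule card_inj_on_le[where f = e])
  show "inj_on e {x \<in> U. P (e x)}" by (rule inj_on_subset[OF inj_e]) auto
qed (use e_mem finite_V in auto)

text \<open>
  If \<open>x\<close> is overtaken by \<open>y\<close>, then either \<open>x\<close> moved up and \<open>y\<close> now lies in a lower class than
  \<open>x\<close>, or \<open>y\<close> moved down and \<open>x\<close> was not in a higher class than \<open>y\<close>. Hence each moved element
  is charged at most twice the size of the larger one of its classes.
\<close>

lemma inversions_reorder_le:
  assumes \<pi>: "\<pi> \<in> configs MS" "consistent p \<pi>" and p: "p \<in> configs EC" "p' \<in> configs EC"
  shows "inversions U \<pi> (reorder p' \<pi>) \<le> 2 * move_cost EC p p'"
proof -
  define up where "up = {x \<in> U. p (e x) < p' (e x)}"
  define down where "down = {y \<in> U. p' (e y) < p (e y)}"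
  define S where "S = (SIGMA x:up. {y \<in> U. p' (e y) < p' (e x)})"
  \<comment> \<open>Here the element moving down comes first, hence the later swap.
    \<open>Suc\<close> includes the class of \<open>y\<close> itself, which doubles the bound to
    twice its old size.\<close>
  define T where "T = (SIGMA y:down. {x \<in> U. p (e x) < Suc (p (e y))})"
  let ?m = "\<lambda>v. max (psize p v) (psize p' v)"
  have fin: "finite up" "finite down" using finite_U by (auto simp: up_def down_def)
  have finST: "finite S" "finite T" using fin finite_U by (auto simp: S_def T_def)
  have "{(x, y). x \<in> U \<and> y \<in> U \<and> \<pi> x < \<pi> y \<and> reorder p' \<pi> y < reorder p' \<pi> x}
      \<subseteq> S \<union> prod.swap ` T"
  proof safe
    fix x y assume xy: "x \<in> U" "y \<in> U" "\<pi> x < \<pi> y" "reorder p' \<pi> y < reorder p' \<pi> x"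
      and "(x, y) \<notin> prod.swap ` T"
    then have "(y, x) \<notin> T" by force
    moreover have "p' (e y) < p' (e x)" using reorder_less_imp[OF \<pi>(1) xy(2,1,4)] xy(3) by auto
    moreover have "p (e x) \<le> p (e y)" using \<pi>(2) xy by (auto simp: consistent_def)
    ultimately show "(x, y) \<in> S" using xy by (auto simp: S_def T_def up_def down_def)
  qed
  then have "inversions U \<pi> (reorder p' \<pi>) \<le> card (S \<union> prod.swap ` T)"
    unfolding inversions_def using finST by (intro card_mono) auto
  also have "\<dots> \<le> card S + card T"
    using card_Un_le[of S "prod.swap ` T"] by (simp add: card_image)
  also have "card S \<le> (\<Sum>x\<in>up. 2 * ?m (e x))"
  proof -
    have "card {y \<in> U. p' (e y) < p' (e x)} \<le> 2 * ?m (e x)" for x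
      using card_preimage_le[of "\<lambda>v. p' v < p' (e x)"] card_lower_classes[OF p(2), of "p' (e x)"]
      by (simp add: psize_def)
    then show ?thesis unfolding S_def using fin finite_U by (simp add: sum_mono)
  qed
  also have "card T \<le> (\<Sum>x\<in>down. 2 * ?m (e x))"
  proof -
    have "card {x \<in> U. p (e x) < Suc (p (e y))} \<le> 2 * ?m (e y)" for y
      using card_preimage_le[of "\<lambda>v. p v < Suc (p (e y))"]
        card_lower_classes[OF p(1), of "Suc (p (e y))"]
      by (simp add: psize_def)
    then show ?thesis unfolding T_def using fin finite_U by (simp add: sum_mono)
  qed
  also have "(\<Sum>x\<in>up. 2 * ?m (e x)) + (\<Sum>x\<in>down. 2 * ?m (e x)) = (\<Sum>x\<in>up \<union> down. 2 * ?m (e x))"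
    using fin by (intro sum.union_disjoint[symmetric]) (auto simp: up_def down_def)
  also have "\<dots> = (\<Sum>v\<in>e ` (up \<union> down). 2 * ?m v)"
    by (subst sum.reindex) (auto simp: up_def down_def intro: inj_on_subset[OF inj_e])
  also have "\<dots> \<le> (\<Sum>v\<in>{v \<in> V. p' v \<noteq> p v}. 2 * ?m v)"
    using finite_V by (intro sum_mono2) (auto simp: up_def down_def e_mem)
  also have "\<dots> = 2 * move_cost EC p p'" by (simp add: sum_distrib_left)
  finally show ?thesis by simp
qed

text \<open>Let \<open>x\<close> attain the caching access cost. By consistency everything up to
  \<open>x\<close> in the list has at most the class of \<open>x\<close>, and those classes hold at
  most \<open>2 ^ Suc (p (e x))\<close> elements, twice the size of \<open>x\<close>.\<close>

lemma access_cost_consistent: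
  assumes \<pi>: "\<pi> \<in> configs MS" "consistent p \<pi>" and p: "p \<in> configs EC"
    and R: "R \<noteq> {}" "R \<subseteq> U"
  shows "access_cost MS \<pi> R \<le> 2 * access_cost EC p (e ` R)"
proof -
  have finR: "finite R" using R finite_U finite_subset by blast
  have "Min (psize p ` e ` R) \<in> psize p ` e ` R"
    using finR R by (intro Min_in) auto
  then obtain x where x: "x \<in> R" "Min (psize p ` e ` R) = psize p (e x)" by auto
  then have xU: "x \<in> U" using R by blast
  have bij: "bij_betw \<pi> U {1..card U}" using \<pi> by simp
  have "{y \<in> U. \<pi> y \<le> \<pi> x} \<subseteq> {y \<in> U. p (e y) < Suc (p (e x))}"
  proof
    fix y assume y: "y \<in> {y \<in> U. \<pi> y \<le> \<pi> x}"
    then have "y = x \<or> \<pi> y < \<pi> x"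
      using bij xU by (auto simp: bij_betw_def inj_on_def order.order_iff_strict)
    then show "y \<in> {y \<in> U. p (e y) < Suc (p (e x))}"
      using y xU \<pi>(2) by (auto simp: consistent_def less_Suc_eq_le)
  qed
  then have "card {y \<in> U. \<pi> y \<le> \<pi> x} \<le> card {y \<in> U. p (e y) < Suc (p (e x))}"
    using finite_U by (intro card_mono) auto
  also have "\<dots> \<le> 2 ^ Suc (p (e x))"
    using card_preimage_le[of "\<lambda>v. p v < Suc (p (e x))"]
      card_lower_classes[OF p, of "Suc (p (e x))"] by linarith
  finally have "\<pi> x \<le> 2 * psize p (e x)"
    using card_positions_le[OF bij xU] by (simp add: psize_def)
  moreover have "Min (\<pi> ` R) \<le> \<pi> x" using finR x by simp
  ultimately show ?thesis using x by simp
qed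

primrec follow :: "(nat \<Rightarrow> config) \<Rightarrow> config \<Rightarrow> nat \<Rightarrow> config" where
  "follow p \<pi> 0 = \<pi>"
| "follow p \<pi> (Suc t) = reorder (p (Suc t)) (follow p \<pi> t)"

text \<open>Expresses that the list at time \<open>t\<close> depends only on partitionings up to
  time \<open>t\<close>, as an online algorithm requires.\<close>

lemma follow_cong: "(\<And>i. i \<le> t \<Longrightarrow> p i = p' i) \<Longrightarrow> follow p \<pi> t = follow p' \<pi> t"
  by (induction t) auto

lemma follow_configs: "\<pi> \<in> configs MS \<Longrightarrow> follow p \<pi> t \<in> configs MS"
  by (induction t) (simp_all del: mssc_simps add: reorder_configs)

lemma follow_consistent:
  assumes "\<pi> \<in> configs MS" "p 0 = initial_partitioning \<pi>"
  shows "consistent (p t) (follow p \<pi> t)"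
  using assms by (cases t)
    (simp_all del: mssc_simps add: initial_partitioning_consistent reorder_consistent follow_configs)

lemma schedule_cost_follow:
  assumes inp: "(\<pi>, Rs) \<in> inputs MS" and p0: "p 0 = initial_partitioning \<pi>"
    and p: "\<And>t. t \<le> length Rs \<Longrightarrow> p t \<in> configs EC"
  shows "schedule_cost MS (follow p \<pi>) Rs \<le> 2 * schedule_cost EC p (lift_sets Rs)"
proof -
  have \<pi>: "\<pi> \<in> configs MS" using inp by (simp add: inputs_def)
  have "access_cost MS (follow p \<pi> t) (Rs ! t)
        + move_cost MS (follow p \<pi> t) (follow p \<pi> (Suc t))
      \<le> 2 * (access_cost EC (p t) (lift_sets Rs ! t) + move_cost EC (p t) (p (Suc t)))"
    if t: "t < length Rs" for t
  proof -
    note inv = follow_configs[OF \<pi>, of p t] follow_consistent[of \<pi> p t, OF \<pi> p0]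
    have "Rs ! t \<noteq> {}" "Rs ! t \<subseteq> U"
      using inp nth_mem[OF t] by (auto simp: inputs_def)
    then have "access_cost MS (follow p \<pi> t) (Rs ! t) \<le> 2 * access_cost EC (p t) (lift_sets Rs ! t)"
      using access_cost_consistent[OF inv p] t by simp
    moreover have "move_cost MS (follow p \<pi> t) (follow p \<pi> (Suc t))
        \<le> 2 * move_cost EC (p t) (p (Suc t))"
      using inversions_reorder_le[OF inv p p, of "Suc t"] t by simp
    ultimately show ?thesis unfolding distrib_left by (rule add_mono)
  qed
  then show ?thesis
    unfolding schedule_cost_def sum_distrib_left by (auto intro!: sum_mono)
qed

subsection \<open>Comparison of the optima\<close>

text \<open>The added elements keep their positions, so only forward moves within \<open>U\<close>
  can raise the excess, and inversions bound their total.\<close>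

lemma excess_pos_shift:
  assumes "\<pi> \<in> configs MS" "\<pi>' \<in> configs MS"
  shows "excess V p (pos \<pi>') \<le> excess V p (pos \<pi>) + 2 * inversions U \<pi> \<pi>'"
proof -
  have "(\<Sum>v\<in>V. pos \<pi> v - pos \<pi>' v) = (\<Sum>v\<in>e ` U. pos \<pi> v - pos \<pi>' v)"
    using finite_V e_into by (intro sum.mono_neutral_right) (auto simp: pos_def)
  also have "\<dots> = (\<Sum>x\<in>U. \<pi> x - \<pi>' x)"
    using inj_e by (simp add: sum.reindex pos_e)
  also have "\<dots> \<le> inversions U \<pi> \<pi>'"
    using assms finite_U by (intro sum_forward_shifts_le_inversions) auto
  finally show ?thesis using excess_shift[of V p "pos \<pi>'" "pos \<pi>"] by linarith
qed

lemma access_cost_settled: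
  assumes "\<forall>v\<in>V. 2 ^ p v \<le> 4 * pos \<pi> v" and R: "R \<noteq> {}" "R \<subseteq> U"
  shows "access_cost EC p (e ` R) \<le> 4 * access_cost MS \<pi> R"
proof -
  have finR: "finite R" using R finite_U finite_subset by blast
  have "Min (\<pi> ` R) \<in> \<pi> ` R" using finR R by (intro Min_in) auto
  then obtain x where x: "x \<in> R" "Min (\<pi> ` R) = \<pi> x" by auto
  then have "x \<in> U" using R by blast
  then have "psize p (e x) \<le> 4 * \<pi> x"
    using assms(1) e_mem pos_e by (metis psize_def)
  moreover have "Min (psize p ` e ` R) \<le> psize p (e x)" using finR x by simp
  ultimately show ?thesis using x by simp
qed

text \<open>Amortization with potential four times the excess. Access loses a factor 4; an inversion
  raises the excess by at most 2, hence the potential by at most 8, and settling is paid from the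
  potential.\<close>

lemma schedule_cost_EC_le:
  assumes inp: "(s 0, Rs) \<in> inputs MS" and s: "\<And>t. t \<le> length Rs \<Longrightarrow> s t \<in> configs MS"
  obtains r where "r 0 = initial_partitioning (s 0)" "\<And>t. t \<le> length Rs \<Longrightarrow> r t \<in> configs EC"
    "schedule_cost EC r (lift_sets Rs) \<le> 8 * schedule_cost MS s Rs"
proof -
  \<comment> \<open>The premises sit under the existential so that a total choice function
    \<open>f\<close> can be extracted.\<close>
  have "\<exists>p'. \<pi> \<in> configs MS \<longrightarrow> p \<in> configs EC \<longrightarrow>
      p' \<in> configs EC \<and> (\<forall>v\<in>V. 2 ^ p' v \<le> 4 * pos \<pi> v) \<and>
      move_cost EC p p' + 4 * excess V p' (pos \<pi>) \<le> 4 * excess V p (pos \<pi>)" for \<pi> p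
    using settle[OF finite_V pos_inj pos_ge_1] by meson
  then obtain f where f: "\<And>\<pi> p. \<pi> \<in> configs MS \<Longrightarrow> p \<in> configs EC \<Longrightarrow>
      f \<pi> p \<in> configs EC \<and> (\<forall>v\<in>V. 2 ^ f \<pi> p v \<le> 4 * pos \<pi> v) \<and>
      move_cost EC p (f \<pi> p) + 4 * excess V (f \<pi> p) (pos \<pi>) \<le> 4 * excess V p (pos \<pi>)"
    by metis
  define r where "r = rec_nat (initial_partitioning (s 0)) (\<lambda>t. f (s (Suc t)))"
  have r0: "r 0 = initial_partitioning (s 0)" and rSuc: "r (Suc t) = f (s (Suc t)) (r t)" for t
    by (simp_all add: r_def)
  have r: "r t \<in> configs EC \<and> (\<forall>v\<in>V. 2 ^ r t v \<le> 4 * pos (s t) v)" if "t \<le> length Rs" for t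
    using that
  proof (induction t)
    case 0
    have "2 ^ r 0 v \<le> 4 * pos (s 0) v" if "v \<in> V" for v
      using two_power_initial_partitioning_le[OF s[OF 0] that] unfolding r0 by linarith
    moreover have "r 0 \<in> configs EC"
      unfolding r0 by (rule initial_partitioning_configs[OF s[OF 0]])
    ultimately show ?case by blast
  next
    case (Suc t)
    then show ?case using f[OF s[OF Suc.prems], of "r t"] unfolding rSuc by simp
  qed
  \<comment> \<open>Prefix form of the cost bound, strengthened by the remaining potential so that
    the induction goes through.\<close>
  have "(\<Sum>i<t. access_cost EC (r i) (lift_sets Rs ! i) + move_cost EC (r i) (r (Suc i)))
        + 4 * excess V (r t) (pos (s t))
      \<le> 8 * (\<Sum>i<t. access_cost MS (s i) (Rs ! i) + move_cost MS (s i) (s (Suc i)))"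
    if "t \<le> length Rs" for t
    using that
  proof (induction t)
    case 0
    have "excess V (r 0) (pos (s 0)) = 0"
      unfolding excess_def r0
    proof (rule sum.neutral, rule ballI)
      fix v assume "v \<in> V"
      then show "2 ^ initial_partitioning (s 0) v - 2 * pos (s 0) v = 0"
        using two_power_initial_partitioning_le[OF s, of 0 v] by simp
    qed
    then show ?case by simp
  next
    case (Suc t)
    then have t: "t \<le> length Rs" "t < length Rs" by auto
    have "Rs ! t \<noteq> {}" "Rs ! t \<subseteq> U"
      using inp nth_mem[OF t(2)] by (auto simp: inputs_def)
    then have acc: "access_cost EC (r t) (lift_sets Rs ! t) \<le> 4 * access_cost MS (s t) (Rs ! t)"
      using access_cost_settled[of "r t" "s t" "Rs ! t"] r[OF t(1)] t(2) by simp
    have mov: "move_cost EC (r t) (r (Suc t)) + 4 * excess V (r (Suc t)) (pos (s (Suc t)))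
        \<le> 4 * excess V (r t) (pos (s (Suc t)))"
      using f[OF s[OF Suc.prems] conjunct1[OF r[OF t(1)]]] unfolding rSuc by blast
    have exc: "excess V (r t) (pos (s (Suc t)))
        \<le> excess V (r t) (pos (s t)) + 2 * move_cost MS (s t) (s (Suc t))"
      using excess_pos_shift[OF s[OF t(1)] s[OF Suc.prems]] by simp
    \<comment> \<open>\<open>E\<close>, \<open>E''\<close> and \<open>E'\<close> stand for the
      excess before the list changes, after it changes, and after settling.\<close>
    have combine: "S + (a + m) + 4 * E' \<le> 8 * (T + (b + d))"
      if "S + 4 * E \<le> 8 * T" "a \<le> 4 * b" "m + 4 * E' \<le> 4 * E''" "E'' \<le> E + 2 * d"
      for S T a b m d E E' E'' :: nat
      using that by simp
    show ?case
      unfolding sum.lessThan_Suc by (rule combine[OF Suc.IH[OF t(1)] acc mov exc])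
  qed
  from this[of "length Rs"] have "schedule_cost EC r (lift_sets Rs) \<le> 8 * schedule_cost MS s Rs"
    by (simp add: schedule_cost_def)
  with r0 r show thesis using that by blast
qed

lemma lift_inputs:
  "(\<pi>, Rs) \<in> inputs MS \<Longrightarrow> (initial_partitioning \<pi>, lift_sets Rs) \<in> inputs EC"
  using initial_partitioning_configs e_into
  by (fastforce simp del: mssc_simps(2) exp_caching_simps(2) simp: inputs_def)

lemma OPT_EC_le:
  assumes "(\<pi>, Rs) \<in> inputs MS"
  shows "OPT EC (initial_partitioning \<pi>) (lift_sets Rs) \<le> 8 * OPT MS \<pi> Rs"
proof -
  let ?S = "{schedule_cost MS s Rs | s. s 0 = \<pi> \<and> (\<forall>t\<le>length Rs. s t \<in> configs MS)}"
  have "\<pi> \<in> configs MS" using assms by (simp add: inputs_def)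
  \<comment> \<open>Never moving is feasible, so the infimum is over a nonempty set of naturals and
    is attained.\<close>
  then have "schedule_cost MS (\<lambda>_. \<pi>) Rs \<in> ?S" by blast
  then have "Inf ?S \<in> ?S" by (intro Inf_nat_def1) blast
  then obtain s where s: "s 0 = \<pi>" "\<And>t. t \<le> length Rs \<Longrightarrow> s t \<in> configs MS"
    "OPT MS \<pi> Rs = schedule_cost MS s Rs" unfolding OPT_def by blast
  obtain r where r: "r 0 = initial_partitioning \<pi>" "\<And>t. t \<le> length Rs \<Longrightarrow> r t \<in> configs EC"
    "schedule_cost EC r (lift_sets Rs) \<le> 8 * schedule_cost MS s Rs"
    using schedule_cost_EC_le[of s Rs] assms s by metis
  have "OPT EC (initial_partitioning \<pi>) (lift_sets Rs) \<le> schedule_cost EC r (lift_sets Rs)"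
    unfolding OPT_def using r by (intro cInf_lower) auto
  with r(3) s(3) show ?thesis by simp
qed

subsection \<open>The derived online algorithm\<close>

text \<open>Algorithms are functions of the history, so the whole simulation is recomputed from the
  sets revealed so far.\<close>

definition derived :: "algorithm \<Rightarrow> algorithm" where
  "derived A \<pi> Rs =
     follow (trajectory A (initial_partitioning \<pi>) (lift_sets Rs)) \<pi> (length Rs)"

text \<open>The simulated algorithm sees the same first \<open>t\<close> sets in either input, so
  recomputing on a prefix reproduces the run on the full input.\<close>

lemma trajectory_derived:
  assumes "t \<le> length Rs"
  shows "trajectory (derived A) \<pi> Rs t
    = follow (trajectory A (initial_partitioning \<pi>) (lift_sets Rs)) \<pi> t"
proof -
  have "follow (trajectory A (initial_partitioning \<pi>) (lift_sets (take t Rs))) \<pi> t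
      = follow (trajectory A (initial_partitioning \<pi>) (lift_sets Rs)) \<pi> t"
    by (rule follow_cong) (simp add: trajectory_def take_map min_def)
  then show ?thesis using assms by (auto simp: trajectory_def derived_def min_def)
qed

lemma derived_configs: "\<pi> \<in> configs MS \<Longrightarrow> derived A \<pi> Rs \<in> configs MS"
  unfolding derived_def by (rule follow_configs)

lemma det_algorithm_derived: "det_algorithm MS (derived A)"
  using derived_configs by (auto simp del: mssc_simps simp: det_algorithm_def inputs_def)

lemma alg_cost_derived:
  assumes inp: "(\<pi>, Rs) \<in> inputs MS" and A: "det_algorithm EC A"
  shows "alg_cost MS (derived A) \<pi> Rs
    \<le> 2 * alg_cost EC A (initial_partitioning \<pi>) (lift_sets Rs)"
proof -
  let ?p = "trajectory A (initial_partitioning \<pi>) (lift_sets Rs)"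
  have "alg_cost MS (derived A) \<pi> Rs = schedule_cost MS (follow ?p \<pi>) Rs"
    unfolding alg_cost_def schedule_cost_def
    by (intro sum.cong refl) (simp add: trajectory_derived)
  also have "\<dots> \<le> 2 * schedule_cost EC ?p (lift_sets Rs)"
  proof (rule schedule_cost_follow[OF inp])
    show "?p t \<in> configs EC" if "t \<le> length Rs" for t
      using trajectory_configs[OF A lift_inputs[OF inp]] that by simp
  qed (simp add: trajectory_def)
  finally show ?thesis by (simp add: alg_cost_def)
qed


section \<open>Measurability of the derived algorithm and transfer of competitiveness\<close>

lemma finite_configs: "finite (configs EC)" "finite (configs MS)"
proof -
  have "configs MS \<subseteq> U \<rightarrow>\<^sub>E {1..card U}" by (auto simp: PiE_def bij_betw_def)
  then show "finite (configs MS)"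
    by (rule finite_subset) (simp add: finite_PiE finite_U)
  have "configs EC \<subseteq> V \<rightarrow>\<^sub>E {..<w}" by auto
  then show "finite (configs EC)"
    by (rule finite_subset) (simp add: finite_PiE finite_V)
qed

text \<open>Induction over time: each reordering is split over the finitely many values of the
  random partitioning that drives it.\<close>

lemma measurable_derived:
  assumes M: "rand_algorithm EC M"
  shows "derived \<in> M \<rightarrow>\<^sub>M decision_algebra MS"
proof (rule measurable_into_decision_algebra)
  fix \<pi> Rs assume inp: "(\<pi>, Rs) \<in> inputs MS"
  have \<pi>: "\<pi> \<in> configs MS" using inp by (simp add: inputs_def)
  let ?p = "\<lambda>A. trajectory A (initial_partitioning \<pi>) (lift_sets Rs)"
  have "(\<lambda>A. follow (?p A) \<pi> t) \<in> M \<rightarrow>\<^sub>M count_space (configs MS)" if "t \<le> length Rs" for t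
    using that
  proof (induction t)
    case 0
    then show ?case using \<pi> by simp
  next
    case (Suc t)
    show ?case unfolding follow.simps
    proof (rule measurable_compose_countable'[where I = "configs EC"
          and f = "\<lambda>q A. reorder q (follow (?p A) \<pi> t)"])
      fix q
      show "(\<lambda>A. reorder q (follow (?p A) \<pi> t)) \<in> M \<rightarrow>\<^sub>M count_space (configs MS)"
        by (rule measurable_compose[where g = "reorder q", OF Suc.IH])
          (use Suc.prems reorder_configs in \<open>auto simp del: mssc_simps\<close>)
      show "(\<lambda>A. ?p A (Suc t)) \<in> M \<rightarrow>\<^sub>M count_space (configs EC)"
        using Suc.prems by (intro measurable_trajectory[OF M lift_inputs[OF inp]]) simp
    qed (rule countable_finite[OF finite_configs(1)])
  qed
  then have "(\<lambda>A. derived A \<pi> Rs) \<in> M \<rightarrow>\<^sub>M count_space (configs MS)"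
    by (simp add: derived_def)
  then show "(\<lambda>A. derived A \<pi> Rs) \<in> M \<rightarrow>\<^sub>M count_space UNIV"
    by (rule measurable_compose[where g = "\<lambda>c. c"]) simp
qed (rule det_algorithm_derived)

text \<open>The factor 16 is 2 for simulating the algorithm times 8 for comparing the optima. Here
  \<open>a\<close> stands for a deterministic or an expected cost.\<close>

lemma competitive_bound:
  fixes c \<xi> a :: real
  assumes "(\<pi>, Rs) \<in> inputs MS" "c \<ge> 1"
    and "a \<le> c * real (OPT EC (initial_partitioning \<pi>) (lift_sets Rs)) + \<xi>"
  shows "2 * a \<le> 16 * c * real (OPT MS \<pi> Rs) + 2 * \<xi>"
proof -
  have "real (OPT EC (initial_partitioning \<pi>) (lift_sets Rs)) \<le> 8 * real (OPT MS \<pi> Rs)"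
    using OPT_EC_le[OF assms(1)] by linarith
  then have "c * real (OPT EC (initial_partitioning \<pi>) (lift_sets Rs))
      \<le> c * (8 * real (OPT MS \<pi> Rs))"
    using assms(2) by (intro mult_left_mono) auto
  with assms(3) show ?thesis by simp
qed

lemma det_competitive_derived:
  assumes "c \<ge> 1" "det_algorithm EC A" "det_competitive EC c A"
  shows "det_competitive MS (16 * c) (derived A)"
proof -
  obtain \<xi> where \<xi>: "\<And>s Rs. (s, Rs) \<in> inputs EC \<Longrightarrow>
      real (alg_cost EC A s Rs) \<le> c * real (OPT EC s Rs) + \<xi>"
    using assms(3) by (auto simp: det_competitive_def)
  have "real (alg_cost MS (derived A) \<pi> Rs) \<le> 16 * c * real (OPT MS \<pi> Rs) + 2 * \<xi>"
    if inp: "(\<pi>, Rs) \<in> inputs MS" for \<pi> Rs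
    using alg_cost_derived[OF inp assms(2)]
      competitive_bound[OF inp assms(1) \<xi>[OF lift_inputs[OF inp]]] by linarith
  then show ?thesis unfolding det_competitive_def by blast
qed

text \<open>The deterministic cost bound holds for every outcome \<open>A\<close>, so it survives
  integration after the expectation is pulled back along \<open>derived\<close>.\<close>

lemma rand_competitive_derived:
  assumes c: "c \<ge> 1" and M: "rand_algorithm EC M" and comp: "rand_competitive EC c M"
  shows "rand_algorithm MS (distr M (decision_algebra MS) derived)"
    and "rand_competitive MS (16 * c) (distr M (decision_algebra MS) derived)"
proof -
  let ?N = "distr M (decision_algebra MS) derived"
  note meas = measurable_derived[OF M]
  show N: "rand_algorithm MS ?N"
    using M meas by (intro rand_algorithm_distr) (auto simp: rand_algorithm_def)
  obtain \<xi> where \<xi>: "\<And>s Rs. (s, Rs) \<in> inputs EC \<Longrightarrow>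
      (\<integral>A. real (alg_cost EC A s Rs) \<partial>M) \<le> c * real (OPT EC s Rs) + \<xi>"
    using comp by (auto simp: rand_competitive_def)
  have "(\<integral>B. real (alg_cost MS B \<pi> Rs) \<partial>?N) \<le> 16 * c * real (OPT MS \<pi> Rs) + 2 * \<xi>"
    if inp: "(\<pi>, Rs) \<in> inputs MS" for \<pi> Rs
  proof -
    let ?p = "initial_partitioning \<pi>" and ?Rs = "lift_sets Rs"
    have int: "integrable ?N (\<lambda>B. real (alg_cost MS B \<pi> Rs))"
      by (rule integrable_alg_cost[OF finite_configs(2) N inp])
    then have borel: "(\<lambda>B. real (alg_cost MS B \<pi> Rs)) \<in> borel_measurable (decision_algebra MS)"
      using borel_measurable_integrable by fastforce
    have "(\<integral>B. real (alg_cost MS B \<pi> Rs) \<partial>?N) = (\<integral>A. real (alg_cost MS (derived A) \<pi> Rs) \<partial>M)"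
      by (rule integral_distr[OF meas borel])
    also have "\<dots> \<le> (\<integral>A. 2 * real (alg_cost EC A ?p ?Rs) \<partial>M)"
    proof (rule integral_mono)
      show "integrable M (\<lambda>A. real (alg_cost MS (derived A) \<pi> Rs))"
        using integrable_distr[OF meas int] .
      show "integrable M (\<lambda>A. 2 * real (alg_cost EC A ?p ?Rs))"
        using integrable_alg_cost[OF finite_configs(1) M lift_inputs[OF inp]] by simp
      fix A assume "A \<in> space M"
      then have "det_algorithm EC A" using M by (simp add: rand_algorithm_def)
      from alg_cost_derived[OF inp this]
      show "real (alg_cost MS (derived A) \<pi> Rs) \<le> 2 * real (alg_cost EC A ?p ?Rs)" by linarith
    qed
    also have "\<dots> = 2 * (\<integral>A. real (alg_cost EC A ?p ?Rs) \<partial>M)" by simp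
    also have "\<dots> \<le> 16 * c * real (OPT MS \<pi> Rs) + 2 * \<xi>"
      by (rule competitive_bound[OF inp c \<xi>[OF lift_inputs[OF inp]]])
    finally show ?thesis .
  qed
  then show "rand_competitive MS (16 * c) ?N" unfolding rand_competitive_def by blast
qed

end

section \<open>Existence of an embedding and conclusion\<close>

lemma embedding_exists:
  assumes "finite V" "card V = 2 ^ w - 1" "finite U" "card U \<le> 2 ^ w - 1"
  shows "\<exists>e \<beta>. embedding w V U e \<beta>"
proof -
  obtain e where e: "inj_on e U" "e ` U \<subseteq> V"
    using assms card_le_inj[of U V] by auto
  have "card (V - e ` U) = card V - card U"
    using e assms(3) by (simp add: card_Diff_subset card_image)
  then have "card (V - e ` U) = card {card U + 1..2 ^ w - 1}"
    unfolding assms(2) by simp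
  then obtain \<beta> where "bij_betw \<beta> (V - e ` U) {card U + 1..2 ^ w - 1}"
    using finite_same_card_bij[OF finite_Diff[OF assms(1)] finite_atLeastAtMost] by blast
  with assms e have "embedding w V U e \<beta>" by unfold_locales auto
  then show ?thesis by blast
qed

theorem theorem1:
  "\<exists>C::real. \<forall>c::real. c \<ge> 1 \<longrightarrow>
     (\<forall>(w::nat) (V::nat set) (U::nat set).
        w \<ge> 1 \<and> finite V \<and> card V = 2 ^ w - 1 \<and> finite U \<and> card U \<le> 2 ^ w - 1 \<longrightarrow>
        ((\<exists>A. det_algorithm (exp_caching w V) A \<and> det_competitive (exp_caching w V) c A) \<longrightarrow>
         (\<exists>B. det_algorithm (mssc U) B \<and> det_competitive (mssc U) (C * c) B)) \<and>
        ((\<exists>M. rand_algorithm (exp_caching w V) M \<and> rand_competitive (exp_caching w V) c M) \<longrightarrow>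
         (\<exists>N. rand_algorithm (mssc U) N \<and> rand_competitive (mssc U) (C * c) N)))"
proof (rule exI[of _ 16], intro allI impI)
  fix c :: real and w :: nat and V U :: "nat set"
  assume c: "c \<ge> 1"
    and "w \<ge> 1 \<and> finite V \<and> card V = 2 ^ w - 1 \<and> finite U \<and> card U \<le> 2 ^ w - 1"
  then obtain e \<beta> where "embedding w V U e \<beta>"
    using embedding_exists by blast
  then interpret embedding w V U e \<beta> .
  show "((\<exists>A. det_algorithm EC A \<and> det_competitive EC c A) \<longrightarrow>
         (\<exists>B. det_algorithm MS B \<and> det_competitive MS (16 * c) B)) \<and>
        ((\<exists>M. rand_algorithm EC M \<and> rand_competitive EC c M) \<longrightarrow>
         (\<exists>N. rand_algorithm MS N \<and> rand_competitive MS (16 * c) N))"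
  proof (intro conjI impI; elim exE conjE)
    fix A assume "det_algorithm EC A" "det_competitive EC c A"
    from det_competitive_derived[OF c this] det_algorithm_derived
    show "\<exists>B. det_algorithm MS B \<and> det_competitive MS (16 * c) B" by blast
  next
    fix M assume "rand_algorithm EC M" "rand_competitive EC c M"
    from rand_competitive_derived[OF c this]
    show "\<exists>N. rand_algorithm MS N \<and> rand_competitive MS (16 * c) N" by blast
  qed
qed

end
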